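(* Let $U,V,W$ be sets. For a correspondence $R\subset U\times V$ and a function $f:U\to\overline{\mathbb R}$, let $\inf[f\mid R]:V\to\overline{\mathbb R}$ and $\sup[f\mid R]:V\to\overline{\mathbb R}$ be the conditional infimum and conditional supremum of $f$ with respect to $R$. The following hold (inequalities and lattice operations between functions are pointwise). 1. Strict epigraph: for any $f:U\to\overline{\mathbb R}$ and any $R\subset U\times V$, $\mathrm{epi}_s\big(\inf[f\mid R]\big)=R^{-1}\,(\mathrm{epi}_s f)$, where on the right-hand side $\mathrm{epi}_s f$ is understood as a correspondence between $U$ and $\mathbb R$ and the expression is a composition of two correspondences, hence a subset of $V\times\mathbb R$. 2. Linearity and sublinearity: for any $R\subset U\times V$, - for any family $(f_i)_{i\in I}$ of functions $f_i:U\to\overline{\mathbb R}$, $\inf\big[\bigwedge_{i\in I}f_i\mid R\big]=\bigwedge_{i\in I}\inf[f_i\mid R]$ and $\bigvee_{i\in I}\inf[f_i\mid R]\le\inf\big[\bigvee_{i\in I}f_i\mid R\big]$; - for any $f:U\to\overline{\mathbb R}$ and $r\in\overline{\mathbb R}$, $\inf[f\dotplus r\mid R]=\inf[f\mid R]\dotplus r$; - for any $f,g:U\to\overline{\mathbb R}$, $\inf[f\mid R]\dotplus\inf[g\mid R]\le\inf[f\dotplus g\mid R]$. 3. Monotony with respect to functions: for any $R\subset U\times V$, - for any $f,g:U\to\overline{\mathbb R}$, $f\le g$ implies $\inf[f\mid R]\le\inf[g\mid R]$; and $\inf_{u\in U}f(u)\le\inf_{u\in RV}f(u)\le\inf[f\mid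 R](v)$ for all $v\in V$; - for any $f:U\to\overline{\mathbb R}$ and any nondecreasing $\varphi:\overline{\mathbb R}\to\overline{\mathbb R}$, $\varphi\circ\inf[f\mid R]\le\inf[\varphi\circ f\mid R]$. 4. Two correspondences on $U\times V$: for any $R,S\subset U\times V$ and any $f:U\to\overline{\mathbb R}$, $\inf[f\mid R\cup S]=\inf[f\mid R]\wedge\inf[f\mid S]$; $\inf[f\mid R\cap S]\ge\inf[f\mid R]\vee\inf[f\mid S]$; and $R\subset S$ implies $\inf[f\mid R]\ge\inf[f\mid S]$. 5. Pushforward property: for any $R\subset U\times V$, any subset $A\subset V$ and any $f:U\to\overline{\mathbb R}$, $\inf_{v\in A}\inf[f\mid R](v)=\inf_{u\in RA}f(u)$. 6. Tower property: for any $R\subset U\times V$ and $S\subset V\times W$, and any $f:U\to\overline{\mathbb R}$, $\inf\big[\inf[f\mid R]\,\big|\,S\big]=\inf[f\mid RS]$. 7. Right composition with mappings: for any $R\subset U\times V$, - for any $g:W\to\overline{\mathbb R}$ and any mapping $\theta:U\to W$, $\inf[g\circ\theta\mid R]=\inf\big[g\mid \mathcal G_\theta^{-1}R\big]$; - for any $f:U\to\overline{\mathbb R}$ and any mapping $\theta:W\to V$, $\inf[f\mid R]\circ\theta=\inf\big[f\mid R\,\mathcal G_\theta^{-1}\big]$. 8. Joint conditional infimum and supremum: for any $R\subset U\times V$ and any $f,g:U\to\overline{\mathbb R}$, $\inf[f\dotplus g\mid R]\le\inf[f\mid R]\dotplus\sup[g\mid R]$ and $\sup[f\,\underset{\cdot}{+}\,g\mid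 R]\ge\sup[f\mid R]\,\underset{\cdot}{+}\,\inf[g\mid R]$.
   Context: $\overline{\mathbb R}=[-\infty,+\infty]$. Moreau additions on $\overline{\mathbb R}$: the upper addition $\dotplus$ and the lower addition $\underset{\cdot}{+}$ extend the usual addition with $(+\infty)\dotplus(-\infty)=(-\infty)\dotplus(+\infty)=+\infty$ and $(+\infty)\underset{\cdot}{+}(-\infty)=(-\infty)\underset{\cdot}{+}(+\infty)=-\infty$. Conventions: an infimum over the empty set is $+\infty$ and a supremum over the empty set is $-\infty$. $\bigwedge,\wedge$ denote (pointwise) infimum and $\bigvee,\vee$ (pointwise) supremum. A correspondence between sets $U$ and $V$ is a subset $R\subset U\times V$; write $uRv$ for $(u,v)\in R$. Foresets: $Rv=\{u\in U: uRv\}$ for $v\in V$, and $RA=\{u\in U:\exists v\in A,\ uRv\}$ for $A\subset V$. Inverse: $R^{-1}\subset V\times U$ with $vR^{-1}u\iff uRv$. Composition: for $R\subset U\times V$ and $S\subset V\times W$, $RS\subset U\times W$ is given by $u(RS)w\iff\exists v\in V,\ uRv\text{ and }vSw$. The graph of a mapping $\theta:U\to W$ is $\mathcal G_\theta=\{(u,w)\in U\times W:\theta(u)=w\}$. Conditional infimum and supremum of $f:U\to\overline{\mathbb R}$ with respect to $R\subset U\times V$: $\inf[f\mid R](v)=\inf_{u\in Rv}f(u)$ and $\sup[f\mid R](v)=\sup_{u\in Rv}f(u)$, for all $v\in V$. Strict epigraph of $f:U\to\overline{\mathbb R}$: $\mathrm{epi}_s f=\{(u,t)\in U\times\mathbb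 R: f(u)<t\}$. *)

theory Defs
  imports "HOL-Library.Extended_Real" "HOL-Library.FuncSet"
begin

text \<open>
  A set is given by a carrier \<open>U :: 'u set\<close>, possibly empty.  A function from \<open>U\<close> to the extended
  reals is represented by a total function of which only the values on \<open>U\<close> matter, so relations
  between functions are stated pointwise on the carrier.  A correspondence between \<open>U\<close> and \<open>V\<close>
  is a relation \<open>R \<subseteq> U \<times> V\<close>; its inverse is the library's \<open>converse\<close> and composition is \<open>O\<close>.
\<close>

text \<open>\<open>foreset R A\<close> is \<open>{u. \<exists>v\<in>A. (u, v) \<in> R}\<close>; the foreset of a point \<open>v\<close> is \<open>foreset R {v}\<close>.\<close>

abbreviation foreset :: "('u \<times> 'v) set \<Rightarrow> 'v set \<Rightarrow> 'u set" where
  "foreset R A \<equiv> R\<inverse> `` A"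

text \<open>
  On \<open>ereal\<close>, the infimum over the empty set is \<open>\<infinity>\<close> and the supremum over the empty set is \<open>-\<infinity>\<close>.
\<close>

definition cond_inf :: "('u \<Rightarrow> ereal) \<Rightarrow> ('u \<times> 'v) set \<Rightarrow> 'v \<Rightarrow> ereal" where
  "cond_inf f R v = (INF u\<in>foreset R {v}. f u)"

definition cond_sup :: "('u \<Rightarrow> ereal) \<Rightarrow> ('u \<times> 'v) set \<Rightarrow> 'v \<Rightarrow> ereal" where
  "cond_sup f R v = (SUP u\<in>foreset R {v}. f u)"

definition strict_epi :: "'u set \<Rightarrow> ('u \<Rightarrow> ereal) \<Rightarrow> ('u \<times> real) set" where
  "strict_epi U f = {(u, t). u \<in> U \<and> f u < ereal t}"

definition graph_on :: "'u set \<Rightarrow> ('u \<Rightarrow> 'w) \<Rightarrow> ('u \<times> 'w) set" where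
  "graph_on U \<theta> = {(u, w). u \<in> U \<and> \<theta> u = w}"

text \<open>Moreau's upper and lower additions.\<close>

definition upper_add :: "ereal \<Rightarrow> ereal \<Rightarrow> ereal" (infixl "+\<^sup>u" 65) where
  "a +\<^sup>u b = (if a = \<infinity> \<or> b = \<infinity> then \<infinity> else a + b)"

definition lower_add :: "ereal \<Rightarrow> ereal \<Rightarrow> ereal" (infixl "+\<^sub>l" 65) where
  "a +\<^sub>l b = (if a = -\<infinity> \<or> b = -\<infinity> then -\<infinity> else a + b)"

text \<open>The library's addition on \<open>ereal\<close> is the upper one.\<close>

lemma upper_add_eq_plus: "a +\<^sup>u b = a + b"
  by (auto simp: upper_add_def)

lemma lower_add_eq_uminus: "a +\<^sub>l b = - ((- a) +\<^sup>u (- b))"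
  by (cases a; cases b) (auto simp: lower_add_def upper_add_def)

end

theory Submission
  imports Defs
begin

text \<open>For fixed \<open>v\<close>, \<open>cond_inf f R v\<close> is an ordinary infimum of
  \<open>f\<close> over the foreset of \<open>v\<close>. Changing the function while keeping
  \<open>R\<close> is therefore order theory of infima (commuting, monotonicity). Changing the
  correspondence is a matter of how foresets behave: those of a union are unions, that of a set is
  the union of those of its points (\<open>INF_cond_inf\<close>), and that of a composition is an
  iterated foreset (\<open>cond_inf_cond_inf\<close>). Arithmetic enters only through
  \<open>INF_ereal_add_const\<close>: upper addition of any constant, infinite or not, commutes with
  any infimum, even an empty one. Bounding \<open>g\<close> by its supremum, a constant on the
  foreset, then gives the joint inequality, and negation turns it into its supremum
  counterpart.\<close>

lemma INF_ereal_add_const: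
  fixes f :: "'a \<Rightarrow> ereal" and r :: ereal
  shows "(INF a\<in>A. f a + r) = (INF a\<in>A. f a) + r"
proof (rule antisym)
  show "(INF a\<in>A. f a) + r \<le> (INF a\<in>A. f a + r)"
    by (intro INF_greatest add_right_mono INF_lower)
  show "(INF a\<in>A. f a + r) \<le> (INF a\<in>A. f a) + r"
  proof (cases r)
    \<comment> \<open>A finite constant can be cancelled: any lower bound of the shifted values,
      lowered by \<open>r\<close>, is a lower bound of \<open>f\<close>.\<close>
    case (real x)
    have "(INF a\<in>A. f a + r) - r \<le> f a" if "a \<in> A" for a
      using INF_lower[OF that, of "\<lambda>a. f a + r"] real by (simp add: ereal_minus_le)
    then have "(INF a\<in>A. f a + r) - r \<le> (INF a\<in>A. f a)"
      by (intro INF_greatest)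
    then show ?thesis
      using real by (simp add: ereal_minus_le)
  next
    case PInf
    then show ?thesis by simp
  next
    case MInf
    \<comment> \<open>The convention for opposite infinities decides this case. If the infimum is
      \<infinity>, which includes empty \<open>A\<close>, the right side is \<infinity>; otherwise
      some value is below \<infinity>, and adding -\<infinity> to it brings the left side down to
      -\<infinity>.\<close>
    show ?thesis
    proof (cases "(INF a\<in>A. f a) = \<infinity>")
      case False
      then obtain a where "a \<in> A" "f a < \<infinity>"
        by (metis INF_less_iff ereal_infty_less(1))
      then show ?thesis
        using INF_lower[of a A "\<lambda>a. f a + r"] MInf by (cases "f a") auto
    qed simp
  qed
qed

lemma cond_inf_add_const: "cond_inf (\<lambda>u. f u +\<^sup>u r) R v = cond_inf f R v +\<^sup>u r"
  unfolding cond_inf_def upper_add_eq_plus by (rule INF_ereal_add_const)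

text \<open>An infimum lies strictly below \<open>t\<close> exactly when some value does. With a
  non-strict inequality this would require the infimum to be attained.\<close>

lemma strict_epi_cond_inf:
  assumes "R \<subseteq> U \<times> V"
  shows "strict_epi V (cond_inf f R) = R\<inverse> O strict_epi U f"
  using assms unfolding strict_epi_def cond_inf_def by (auto simp: INF_less_iff)

lemma cond_inf_INF: "cond_inf (\<lambda>u. INF i\<in>I. f i u) R v = (INF i\<in>I. cond_inf (f i) R v)"
  unfolding cond_inf_def by (rule INF_commute)

lemma SUP_cond_inf_le: "(SUP i\<in>I. cond_inf (f i) R v) \<le> cond_inf (\<lambda>u. SUP i\<in>I. f i u) R v"
  unfolding cond_inf_def by (intro SUP_least INF_greatest) (meson INF_lower SUP_upper order_trans)

lemma cond_inf_add_le: "cond_inf f R v +\<^sup>u cond_inf g R v \<le> cond_inf (\<lambda>u. f u +\<^sup>u g u) R v"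
  unfolding cond_inf_def upper_add_eq_plus by (intro INF_greatest add_mono INF_lower)

lemma cond_inf_mono:
  assumes "\<And>u. (u, v) \<in> R \<Longrightarrow> f u \<le> g u"
  shows "cond_inf f R v \<le> cond_inf g R v"
  unfolding cond_inf_def using assms by (intro INF_mono) auto

lemma mono_cond_inf_le: "mono \<phi> \<Longrightarrow> \<phi> (cond_inf f R v) \<le> cond_inf (\<phi> \<circ> f) R v"
  unfolding cond_inf_def by (auto intro!: INF_greatest monoD[of \<phi>] INF_lower)

lemma cond_inf_Un: "cond_inf f (R \<union> S) v = inf (cond_inf f R v) (cond_inf f S v)"
  unfolding cond_inf_def by (simp add: converse_Un Un_Image INF_union)

lemma cond_inf_antimono: "R \<subseteq> S \<Longrightarrow> cond_inf f S v \<le> cond_inf f R v"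
  unfolding cond_inf_def by (rule INF_superset_mono) auto

text \<open>An iterated infimum is one infimum over the union of the index sets.\<close>

lemma INF_cond_inf: "(INF v\<in>A. cond_inf f R v) = (INF u\<in>foreset R A. f u)"
proof (rule antisym)
  show "(INF v\<in>A. cond_inf f R v) \<le> (INF u\<in>foreset R A. f u)"
    unfolding cond_inf_def by (rule INF_greatest) (auto intro: INF_lower2)
  show "(INF u\<in>foreset R A. f u) \<le> (INF v\<in>A. cond_inf f R v)"
    unfolding cond_inf_def by (intro INF_greatest INF_lower) auto
qed

text \<open>This is \<open>INF_cond_inf\<close> with \<open>A\<close> the foreset of
  \<open>w\<close> under \<open>S\<close>.\<close>

lemma cond_inf_cond_inf: "cond_inf (cond_inf f R) S w = cond_inf f (R O S) w"
  unfolding cond_inf_def[of _ S] INF_cond_inf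
  by (simp add: cond_inf_def converse_relcomp relcomp_Image)

lemma cond_inf_comp_left:
  assumes "R \<subseteq> U \<times> V"
  shows "cond_inf (g \<circ> \<theta>) R v = cond_inf g ((graph_on U \<theta>)\<inverse> O R) v"
proof -
  \<comment> \<open>The inclusion of \<open>R\<close> in \<open>U \<times> V\<close> puts the whole
    foreset inside \<open>U\<close>, where the graph is defined.\<close>
  have "foreset ((graph_on U \<theta>)\<inverse> O R) {v} = \<theta> ` foreset R {v}"
    using assms unfolding graph_on_def by auto
  then show ?thesis unfolding cond_inf_def by (simp add: image_comp)
qed

lemma cond_inf_comp_right:
  assumes "w \<in> W"
  shows "(cond_inf f R \<circ> \<theta>) w = cond_inf f (R O (graph_on W \<theta>)\<inverse>) w"
proof -
  have "foreset (R O (graph_on W \<theta>)\<inverse>) {w} = foreset R {\<theta> w}"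
    using assms unfolding graph_on_def by auto
  then show ?thesis unfolding cond_inf_def by simp
qed

lemma cond_inf_add_le_cond_sup:
  "cond_inf (\<lambda>u. f u +\<^sup>u g u) R v \<le> cond_inf f R v +\<^sup>u cond_sup g R v"
proof -
  have "cond_inf (\<lambda>u. f u +\<^sup>u g u) R v \<le> cond_inf (\<lambda>u. f u +\<^sup>u cond_sup g R v) R v"
    by (rule cond_inf_mono)
      (auto simp: upper_add_eq_plus cond_sup_def intro!: add_left_mono SUP_upper)
  then show ?thesis by (simp add: cond_inf_add_const)
qed

lemma cond_sup_eq_uminus: "cond_sup f R v = - cond_inf (\<lambda>u. - f u) R v"
  by (simp add: cond_sup_def cond_inf_def ereal_INF_uminus_eq)

text \<open>Negation exchanges infimum with supremum and upper with lower addition, so this is the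
  preceding inequality for \<open>- f\<close> and \<open>- g\<close>, negated.\<close>

lemma cond_sup_lower_add_ge:
  "cond_sup f R v +\<^sub>l cond_inf g R v \<le> cond_sup (\<lambda>u. f u +\<^sub>l g u) R v"
  using cond_inf_add_le_cond_sup[of "\<lambda>u. - f u" "\<lambda>u. - g u" R v]
  by (simp add: lower_add_eq_uminus cond_sup_eq_uminus)

theorem proposition2:
  fixes U :: "'u set" and V :: "'v set" and W :: "'w set"
  shows
    "(\<forall>f :: 'u \<Rightarrow> ereal. \<forall>R\<subseteq>U \<times> V. strict_epi V (cond_inf f R) = R\<inverse> O strict_epi U f)
   \<and>
     (\<forall>R\<subseteq>U \<times> V.
        (\<forall>(I :: 'i set) (f :: 'i \<Rightarrow> 'u \<Rightarrow> ereal). \<forall>v\<in>V.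
            cond_inf (\<lambda>u. INF i\<in>I. f i u) R v = (INF i\<in>I. cond_inf (f i) R v)
          \<and> (SUP i\<in>I. cond_inf (f i) R v) \<le> cond_inf (\<lambda>u. SUP i\<in>I. f i u) R v)
      \<and> (\<forall>(f :: 'u \<Rightarrow> ereal) (r :: ereal). \<forall>v\<in>V.
            cond_inf (\<lambda>u. f u +\<^sup>u r) R v = cond_inf f R v +\<^sup>u r)
      \<and> (\<forall>(f :: 'u \<Rightarrow> ereal) (g :: 'u \<Rightarrow> ereal). \<forall>v\<in>V.
            cond_inf f R v +\<^sup>u cond_inf g R v \<le> cond_inf (\<lambda>u. f u +\<^sup>u g u) R v))
   \<and>
     (\<forall>R\<subseteq>U \<times> V.
        (\<forall>(f :: 'u \<Rightarrow> ereal) (g :: 'u \<Rightarrow> ereal).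
            (\<forall>u\<in>U. f u \<le> g u) \<longrightarrow> (\<forall>v\<in>V. cond_inf f R v \<le> cond_inf g R v))
      \<and> (\<forall>f :: 'u \<Rightarrow> ereal.
            (INF u\<in>U. f u) \<le> (INF u\<in>foreset R V. f u)
          \<and> (\<forall>v\<in>V. (INF u\<in>foreset R V. f u) \<le> cond_inf f R v))
      \<and> (\<forall>(f :: 'u \<Rightarrow> ereal) (\<phi> :: ereal \<Rightarrow> ereal). mono \<phi> \<longrightarrow>
            (\<forall>v\<in>V. \<phi> (cond_inf f R v) \<le> cond_inf (\<phi> \<circ> f) R v)))
   \<and>
     (\<forall>R\<subseteq>U \<times> V. \<forall>S\<subseteq>U \<times> V. \<forall>f :: 'u \<Rightarrow> ereal.
        (\<forall>v\<in>V. cond_inf f (R \<union> S) v = inf (cond_inf f R v) (cond_inf f S v))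
      \<and> (\<forall>v\<in>V. cond_inf f (R \<inter> S) v \<ge> sup (cond_inf f R v) (cond_inf f S v))
      \<and> (R \<subseteq> S \<longrightarrow> (\<forall>v\<in>V. cond_inf f R v \<ge> cond_inf f S v)))
   \<and>
     (\<forall>R\<subseteq>U \<times> V. \<forall>A\<subseteq>V. \<forall>f :: 'u \<Rightarrow> ereal.
        (INF v\<in>A. cond_inf f R v) = (INF u\<in>foreset R A. f u))
   \<and>
     (\<forall>R\<subseteq>U \<times> V. \<forall>S\<subseteq>V \<times> W. \<forall>f :: 'u \<Rightarrow> ereal. \<forall>w\<in>W.
        cond_inf (cond_inf f R) S w = cond_inf f (R O S) w)
   \<and>
     (\<forall>R\<subseteq>U \<times> V.
        (\<forall>g :: 'w \<Rightarrow> ereal. \<forall>\<theta>\<in>U \<rightarrow> W. \<forall>v\<in>V.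
            cond_inf (g \<circ> \<theta>) R v = cond_inf g ((graph_on U \<theta>)\<inverse> O R) v)
      \<and> (\<forall>f :: 'u \<Rightarrow> ereal. \<forall>\<theta>\<in>W \<rightarrow> V. \<forall>w\<in>W.
            (cond_inf f R \<circ> \<theta>) w = cond_inf f (R O (graph_on W \<theta>)\<inverse>) w))
   \<and>
     (\<forall>R\<subseteq>U \<times> V. \<forall>(f :: 'u \<Rightarrow> ereal) (g :: 'u \<Rightarrow> ereal). \<forall>v\<in>V.
        cond_inf (\<lambda>u. f u +\<^sup>u g u) R v \<le> cond_inf f R v +\<^sup>u cond_sup g R v
      \<and> cond_sup (\<lambda>u. f u +\<^sub>l g u) R v \<ge> cond_sup f R v +\<^sub>l cond_inf g R v)"
proof (intro conjI allI ballI impI)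
  fix R :: "('u \<times> 'v) set" and f :: "'u \<Rightarrow> ereal"
  assume R: "R \<subseteq> U \<times> V"
  \<comment> \<open>Both inequalities come from the chain
    \<open>foreset R {v} \<subseteq> foreset R V \<subseteq> U\<close>: enlarging the index set
    lowers the infimum.\<close>
  show "(INF u\<in>U. f u) \<le> (INF u\<in>foreset R V. f u)"
    using R by (intro INF_superset_mono) auto
  show "(INF u\<in>foreset R V. f u) \<le> cond_inf f R v" if "v \<in> V" for v
    unfolding cond_inf_def using that by (intro INF_superset_mono) auto
  show "cond_inf f R v \<le> cond_inf g R v" if "\<forall>u\<in>U. f u \<le> g u" for g v
    using R that by (intro cond_inf_mono) auto
  show "cond_inf (g \<circ> \<theta>) R v = cond_inf g ((graph_on U \<theta>)\<inverse> O R) v"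
    for g :: "'w \<Rightarrow> ereal" and \<theta> v
    using R by (rule cond_inf_comp_left)
next
  fix R S :: "('u \<times> 'v) set" and f :: "'u \<Rightarrow> ereal" and v
  show "sup (cond_inf f R v) (cond_inf f S v) \<le> cond_inf f (R \<inter> S) v"
    by (intro sup_least cond_inf_antimono) auto
qed (simp_all only: strict_epi_cond_inf cond_inf_INF SUP_cond_inf_le cond_inf_add_const
    cond_inf_add_le mono_cond_inf_le cond_inf_Un cond_inf_antimono INF_cond_inf
    cond_inf_cond_inf cond_inf_comp_right cond_inf_add_le_cond_sup cond_sup_lower_add_ge)

end
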